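(* Let $q$ be a prime power and $0<k<n$, $0\le t\le k$ integers. If $q>\binom{n}{t}$ and $t<k$, then the graph $\Lambda_t(n,k)$ is connected. If $t=k$, the graph $\Lambda_k(n,k)$ is totally disconnected (it has no edges).
   Context: Let $V=\mathbb{F}_q^n$ with its standard basis. An $[n,m]$-linear code is an $m$-dimensional subspace of $V$; a generator matrix is an $m\times n$ matrix whose rows form a basis of it. $\mathcal{C}_t(n,m)$ denotes the set of $[n,m]$-codes such that any $t$ columns of a generator matrix are linearly independent. $\Lambda_t(n,k)$ is the graph with vertex set $\mathcal{C}_t(n,k)$ in which $X,Y$ are adjacent iff $X\cap Y\in\mathcal{C}_t(n,k-1)$. The empty graph is considered connected. *)

theory Defs
  imports "HOL-Analysis.Cartesian_Space" "Graph_Theory.Graph_Theory"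
begin

text \<open>
  The field with q elements is a type \<open>'a\<close> of sort \<open>{finite, field}\<close>, and \<open>V\<close> is
  \<open>'a ^ 'n\<close>; thus q and n are \<open>CARD('a)\<close> and \<open>CARD('n)\<close>.
\<close>

definition linear_code :: "nat \<Rightarrow> ('a::field ^ 'n::finite) set \<Rightarrow> bool" where
  "linear_code m X \<longleftrightarrow> vec.subspace X \<and> vec.dim X = m"

text \<open>
  The number of rows of a generator matrix varies within one statement (k and k - 1), so a
  matrix with m rows is a map \<open>nat \<Rightarrow> 'a ^ 'n\<close> of which only the rows \<open>i < m\<close> matter.
\<close>

definition generator_matrix :: "nat \<Rightarrow> (nat \<Rightarrow> 'a::field ^ 'n::finite) \<Rightarrow> ('a ^ 'n) set \<Rightarrow> bool" where
  "generator_matrix m G X \<longleftrightarrow>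
     inj_on G {..<m} \<and> vec.independent (G ` {..<m}) \<and> vec.span (G ` {..<m}) = X"

text \<open>
  The columns with indices in \<open>J\<close> are linearly independent as a family, so two equal columns
  at different positions are dependent.
\<close>

definition columns_independent ::
    "nat \<Rightarrow> (nat \<Rightarrow> 'a::field ^ 'n::finite) \<Rightarrow> 'n set \<Rightarrow> bool" where
  "columns_independent m G J \<longleftrightarrow>
     (\<forall>c :: 'n \<Rightarrow> 'a. (\<forall>i<m. (\<Sum>j\<in>J. c j * G i $ j) = 0) \<longrightarrow> (\<forall>j\<in>J. c j = 0))"

definition codes :: "nat \<Rightarrow> nat \<Rightarrow> ('a::field ^ 'n::finite) set set" where
  "codes t m = {X. linear_code m X \<and>
     (\<exists>G. generator_matrix m G X \<and> (\<forall>J. card J = t \<longrightarrow> columns_independent m G J))}"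

definition code_graph :: "nat \<Rightarrow> nat \<Rightarrow> ('a::field ^ 'n::finite) set pair_pre_digraph" where
  "code_graph t k = \<lparr> pverts = codes t k,
     parcs = {(X, Y). X \<in> codes t k \<and> Y \<in> codes t k \<and> X \<inter> Y \<in> codes t (k - 1)} \<rparr>"

text \<open>The library's notion of connectedness excludes the empty graph.\<close>

definition graph_connected :: "'v pair_pre_digraph \<Rightarrow> bool" where
  "graph_connected G \<longleftrightarrow> pverts G = {} \<or> Digraph_Component.connected (with_proj G)"

text \<open>
  The definition of \<open>codes\<close> does not depend on the choice of the generator matrix, and every
  m-dimensional subspace has one.
\<close>

lemma columns_independent_iff:
  fixes X :: "('a::field ^ 'n::finite) set"
  assumes "generator_matrix m G X"
  shows "columns_independent m G J \<longleftrightarrow>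
    (\<forall>c :: 'n \<Rightarrow> 'a. (\<forall>x\<in>X. (\<Sum>j\<in>J. c j * x $ j) = 0) \<longrightarrow> (\<forall>j\<in>J. c j = 0))"
proof -
  have "(\<forall>i<m. (\<Sum>j\<in>J. c j * G i $ j) = 0) \<longleftrightarrow> (\<forall>x\<in>X. (\<Sum>j\<in>J. c j * x $ j) = 0)"
    for c :: "'n \<Rightarrow> 'a"
  proof
    assume rows: "\<forall>i<m. (\<Sum>j\<in>J. c j * G i $ j) = 0"
    let ?S = "{x. (\<Sum>j\<in>J. c j * x $ j) = 0}"
    have "vec.subspace ?S"
      by (auto simp: vec.subspace_def distrib_left sum.distrib mult.left_commute
          simp flip: sum_distrib_left)
    moreover have "G ` {..<m} \<subseteq> ?S"
      using rows by auto
    ultimately have "vec.span (G ` {..<m}) \<subseteq> ?S"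
      by (rule vec.span_minimal[rotated])
    then show "\<forall>x\<in>X. (\<Sum>j\<in>J. c j * x $ j) = 0"
      using assms by (auto simp: generator_matrix_def)
  next
    assume "\<forall>x\<in>X. (\<Sum>j\<in>J. c j * x $ j) = 0"
    then show "\<forall>i<m. (\<Sum>j\<in>J. c j * G i $ j) = 0"
      using assms by (auto simp: generator_matrix_def intro: vec.span_base)
  qed
  then show ?thesis
    by (simp add: columns_independent_def)
qed

lemma generator_matrix_exists:
  fixes X :: "('a::field ^ 'n::finite) set"
  assumes "linear_code m X"
  shows "\<exists>G. generator_matrix m G X"
proof -
  obtain B where B: "B \<subseteq> X" "vec.independent B" "X \<subseteq> vec.span B" "card B = vec.dim X"
    using vec.basis_exists by blast
  have "finite B"
    using B(2) by (rule vec.finiteI_independent)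
  moreover have "card B = m"
    using B(4) assms by (simp add: linear_code_def)
  ultimately obtain G where G: "bij_betw G {..<m} B"
    using ex_bij_betw_nat_finite[of B] by (auto simp: atLeast0LessThan)
  have "vec.span B = X"
    using B assms by (auto simp: linear_code_def dest: vec.span_minimal)
  then show ?thesis
    using G B(2) by (auto simp: generator_matrix_def bij_betw_def)
qed

lemma codes_all_generator_matrices:
  "codes t m = {X :: ('a::field ^ 'n::finite) set. linear_code m X \<and>
     (\<forall>G. generator_matrix m G X \<longrightarrow> (\<forall>J. card J = t \<longrightarrow> columns_independent m G J))}"
proof -
  have "columns_independent m G J = columns_independent m H J"
    if "generator_matrix m G X" "generator_matrix m H X"
    for G H :: "nat \<Rightarrow> 'a ^ 'n" and X J
    using that by (simp only: columns_independent_iff)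
  then show ?thesis
    unfolding codes_def by (intro Collect_cong) (metis generator_matrix_exists)
qed

end

theory Submission
  imports Defs
begin

text \<open>
  A code of dimension k lies in \<open>codes t k\<close> iff it projects onto every set J of t coordinates.
  If t < k, it then contains nonzero words vanishing on J, and a hyperplane of the code stays in
  \<open>codes t (k - 1)\<close> as soon as, for every J, its defining functional is nonzero on one such word.

  Let X and Y be two codes with intersection D of dimension d. For those J for which D contains a
  nonzero word vanishing on J, choose such a word in D; since there are at most
  \<open>n choose t < q\<close> of them, some functional on D is nonzero on all the chosen words. For the
  remaining J the chosen words of X lie outside D, so the functional on D extends to one on X
  that is nonzero on them as well; the same holds for Y. This yields hyperplanes X' of X and Y' of Y
  in \<open>codes t (k - 1)\<close> that meet D in the same subspace, of dimension at least d - 1. For x in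
  X' but not in Y and y in Y' but not in X, the codes spanned by X' and y and by Y' and x are
  neighbours of X and Y respectively, and their intersection has dimension at least d + 1. Induction
  on k - d connects X and Y.

  For t = k there are no edges, because a code that projects onto k coordinates has dimension at
  least k.
\<close>

subsection \<open>Linear functionals avoiding zeros\<close>

text \<open>Closure under affine combinations alone lets this apply to all functionals with
  prescribed values on a subspace, which in general form no vector space.\<close>

lemma ex_all_nonzero_of_affine_family:
  fixes P :: "('b \<Rightarrow> 'a::{finite,field}) set" and v :: "'i \<Rightarrow> 'b"
  assumes affine: "\<And>f g s. f \<in> P \<Longrightarrow> g \<in> P \<Longrightarrow> (\<lambda>x. f x + s * (g x - f x)) \<in> P"
    and "P \<noteq> {}" and "finite I" and "card I < CARD('a)"
    and "\<And>i. i \<in> I \<Longrightarrow> \<exists>f\<in>P. f (v i) \<noteq> 0"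
  shows "\<exists>f\<in>P. \<forall>i\<in>I. f (v i) \<noteq> 0"
  using assms(3-5)
proof (induction I rule: finite_induct)
  case empty
  then show ?case using \<open>P \<noteq> {}\<close> by auto
next
  case (insert j I)
  have "\<exists>f\<in>P. \<forall>i\<in>I. f (v i) \<noteq> 0"
    using insert.prems insert.hyps by (intro insert.IH) auto
  then obtain f where f: "f \<in> P" "\<And>i. i \<in> I \<Longrightarrow> f (v i) \<noteq> 0"
    by blast
  obtain g where g: "g \<in> P" "g (v j) \<noteq> 0"
    using insert.prems by blast
  \<comment> \<open>On the line through f and g each evaluation is a nonzero affine function of the parameter s,
    whose only possible root is \<open>bad i\<close>.\<close>
  define bad where "bad i = - f (v i) / (g (v i) - f (v i))" for i
  have "card (bad ` insert j I) \<le> card (insert j I)"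
    by (rule card_image_le) (use insert.hyps in simp)
  then have "bad ` insert j I \<noteq> UNIV"
    using insert.prems(1) by auto
  then obtain s where s: "s \<notin> bad ` insert j I"
    by blast
  have "f (v i) + s * (g (v i) - f (v i)) \<noteq> 0" if i: "i \<in> insert j I" for i
  proof (cases "g (v i) = f (v i)")
    case True
    then show ?thesis using f g i by auto
  next
    case False
    have "s \<noteq> bad i" using s i by auto
    moreover have "s = bad i" if "f (v i) + s * (g (v i) - f (v i)) = 0"
      unfolding bad_def using False that
      by (subst nonzero_eq_divide_eq) (simp_all add: eq_neg_iff_add_eq_0 add.commute)
    ultimately show ?thesis by blast
  qed
  then show ?case
    using affine[OF f(1) g(1)] by (intro bexI[where x = "\<lambda>x. f x + s * (g x - f x)"]) auto
qed

lemma functional_extend: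
  fixes D :: "('a::field ^ 'n::finite) set"
  assumes "vec.subspace D" and "w \<notin> D" and g: "Vector_Spaces.linear (*s) (*) g"
  shows "\<exists>f. Vector_Spaces.linear (*s) (*) f \<and> (\<forall>x\<in>D. f x = g x) \<and> f w = (c::'a)"
proof -
  interpret vector_space_pair "(*s) :: 'a \<Rightarrow> 'a ^ 'n \<Rightarrow> 'a ^ 'n" "(*) :: 'a \<Rightarrow> 'a \<Rightarrow> 'a" ..
  obtain B where B: "B \<subseteq> D" "vec.independent B" "D \<subseteq> vec.span B"
    by (rule vec.basis_exists[of D])
  have "vec.span B \<subseteq> D"
    using B(1) assms(1) by (rule vec.span_minimal)
  then have w: "w \<notin> vec.span B" using assms(2) by blast
  then have "vec.independent (insert w B)"
    using B(2) by (simp add: vec.independent_insertI)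
  from linear_independent_extend[OF this, of "\<lambda>x. if x = w then c else g x"]
  obtain f where f: "Vector_Spaces.linear (*s) (*) f"
    "\<forall>x\<in>insert w B. f x = (if x = w then c else g x)"
    by blast
  have "w \<notin> B" using w vec.span_base by blast
  then have "f x = g x" if "x \<in> B" for x using f(2) that by auto
  then have "f x = g x" if "x \<in> D" for x
    using linear_eq_on[OF f(1) g, of x B] that B(3) by blast
  then show ?thesis using f by auto
qed

text \<open>The extensions of \<open>g\<close> from \<open>D\<close> form an affine family, and
  because \<open>v i\<close> lies outside \<open>D\<close>, some extension takes the value 1
  there.\<close>

lemma functional_extend_nonzero:
  fixes D :: "('a::{finite,field} ^ 'n::finite) set"
  assumes D: "vec.subspace D" and g: "Vector_Spaces.linear (*s) (*) g"
    and "finite I" and "card I < CARD('a)" and v: "\<And>i. i \<in> I \<Longrightarrow> v i \<notin> D"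
  shows "\<exists>f. Vector_Spaces.linear (*s) (*) f \<and> (\<forall>x\<in>D. f x = g x) \<and> (\<forall>i\<in>I. f (v i) \<noteq> (0::'a))"
proof -
  let ?P = "{f. Vector_Spaces.linear (*s) (*) f \<and> (\<forall>x\<in>D. f x = g x)}"
  interpret vector_space_pair "(*s) :: 'a \<Rightarrow> 'a ^ 'n \<Rightarrow> 'a ^ 'n" "(*) :: 'a \<Rightarrow> 'a \<Rightarrow> 'a" ..
  have "\<exists>f\<in>?P. \<forall>i\<in>I. f (v i) \<noteq> 0"
  proof (rule ex_all_nonzero_of_affine_family)
    show "(\<lambda>x. f x + s * (h x - f x)) \<in> ?P" if "f \<in> ?P" "h \<in> ?P" for f h s
      using that by (auto intro!: linear_compose_add linear_compose_scale_right linear_compose_sub)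
    show "?P \<noteq> {}" using g by auto
    show "\<exists>f\<in>?P. f (v i) \<noteq> 0" if "i \<in> I" for i
      using functional_extend[OF D v[OF that] g, of 1] by auto
  qed fact+
  then show ?thesis by blast
qed

text \<open>The sets \<open>C i\<close> stand for the words vanishing on a set of t coordinates.
  Since \<open>f\<close> and \<open>g\<close> must agree on \<open>X \<inter> Y\<close>, a common
  functional is fixed first, and its values there are extended separately to each side.\<close>

lemma functionals_agreeing_on_intersection:
  fixes X Y :: "('a::{finite,field} ^ 'n::finite) set"
  assumes X: "vec.subspace X" and Y: "vec.subspace Y" and I: "finite I" "card I < CARD('a)"
    and CX: "\<And>i. i \<in> I \<Longrightarrow> \<exists>v\<in>X \<inter> C i. v \<noteq> 0"
    and CY: "\<And>i. i \<in> I \<Longrightarrow> \<exists>v\<in>Y \<inter> C i. v \<noteq> 0"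
  obtains f g :: "'a ^ 'n \<Rightarrow> 'a" where
    "Vector_Spaces.linear (*s) (*) f" "Vector_Spaces.linear (*s) (*) g"
    "\<And>x. x \<in> X \<inter> Y \<Longrightarrow> f x = g x"
    "\<And>i. i \<in> I \<Longrightarrow> \<exists>v\<in>X \<inter> C i. f v \<noteq> 0"
    "\<And>i. i \<in> I \<Longrightarrow> \<exists>v\<in>Y \<inter> C i. g v \<noteq> 0"
proof -
  interpret vector_space_pair "(*s) :: 'a \<Rightarrow> 'a ^ 'n \<Rightarrow> 'a ^ 'n" "(*) :: 'a \<Rightarrow> 'a \<Rightarrow> 'a" ..
  \<comment> \<open>For these indices a word of the intersection settles the matter. For the others
    every nonzero candidate in \<open>X\<close> or \<open>Y\<close> lies outside the intersection,
    where an extension is still free.\<close>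
  define I1 where "I1 = {i\<in>I. \<exists>v\<in>X \<inter> Y \<inter> C i. v \<noteq> 0}"
  have I1: "finite I1" "card I1 < CARD('a)"
    using I card_mono[of I I1] by (auto simp: I1_def)
  have I2: "finite (I - I1)" "card (I - I1) < CARD('a)"
    using I card_mono[of I "I - I1"] by auto
  obtain v where v: "v i \<in> X \<inter> Y \<inter> C i" "v i \<noteq> 0" if "i \<in> I1" for i
  proof -
    have "\<forall>i\<in>I1. \<exists>v. v \<in> X \<inter> Y \<inter> C i \<and> v \<noteq> 0" by (auto simp: I1_def)
    then show ?thesis using that by (metis bchoice)
  qed
  \<comment> \<open>Extending from the zero subspace imposes no constraint, so \<open>h\<close> is
    just a functional that is nonzero on all the \<open>v i\<close>.\<close>
  have "\<exists>h. Vector_Spaces.linear (*s) (*) h \<and> (\<forall>x\<in>{0}. h x = 0) \<and> (\<forall>i\<in>I1. h (v i) \<noteq> (0::'a))"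
    by (rule functional_extend_nonzero[OF vec.subspace_single_0 linear_zero I1]) (use v in auto)
  then obtain h where h: "Vector_Spaces.linear (*s) (*) h" "\<And>i. i \<in> I1 \<Longrightarrow> h (v i) \<noteq> (0::'a)"
    by blast
  have ext: "\<exists>f. Vector_Spaces.linear (*s) (*) f \<and> (\<forall>x\<in>X \<inter> Y. f x = h x) \<and>
      (\<forall>i\<in>I. \<exists>w\<in>Z \<inter> C i. f w \<noteq> (0::'a))"
    if Z: "X \<inter> Y \<subseteq> Z" "\<And>i. i \<in> I \<Longrightarrow> \<exists>w\<in>Z \<inter> C i. w \<noteq> 0" for Z
  proof -
    obtain w where w: "w i \<in> Z \<inter> C i" "w i \<noteq> 0" if "i \<in> I" for i
      using Z(2) by metis
    have "w i \<notin> X \<inter> Y" if "i \<in> I - I1" for i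
      using w[of i] that by (auto simp: I1_def)
    from functional_extend_nonzero[OF vec.subspace_inter[OF X Y] h(1) I2, of w, OF this]
    obtain f where f: "Vector_Spaces.linear (*s) (*) f" "\<forall>x\<in>X \<inter> Y. f x = h x"
      "\<forall>i\<in>I - I1. f (w i) \<noteq> 0"
      by blast
    have "\<exists>w\<in>Z \<inter> C i. f w \<noteq> 0" if "i \<in> I" for i
    proof (cases "i \<in> I1")
      case True
      then have "v i \<in> Z \<inter> C i" "f (v i) \<noteq> 0"
        using v(1)[OF True] h(2)[OF True] f(2) Z(1) by auto
      then show ?thesis by blast
    next
      case False
      then show ?thesis using f(3) w(1) that by blast
    qed
    then show ?thesis using f by blast
  qed
  obtain f g where
    "Vector_Spaces.linear (*s) (*) f" "\<forall>x\<in>X \<inter> Y. f x = h x" "\<forall>i\<in>I. \<exists>w\<in>X \<inter> C i. f w \<noteq> 0"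
    "Vector_Spaces.linear (*s) (*) g" "\<forall>x\<in>X \<inter> Y. g x = h x" "\<forall>i\<in>I. \<exists>w\<in>Y \<inter> C i. g w \<noteq> 0"
    using ext[OF Int_lower1 CX] ext[OF Int_lower2 CY] by blast
  then show thesis by (intro that[of f g]) auto
qed

subsection \<open>Hyperplanes of codes\<close>

lemma subspace_kernel:
  assumes "vec.subspace X" and "Vector_Spaces.linear (*s) (*) f"
  shows "vec.subspace {x\<in>X. f x = (0::'a::field)}"
proof -
  interpret f: Vector_Spaces.linear "(*s)" "(*)" f by fact
  show ?thesis
    using assms(1) by (auto simp: vec.subspace_def f.add f.scale)
qed

text \<open>Modulo the kernel, every \<open>x\<close> in \<open>X\<close> equals \<open>v\<close>
  scaled by \<open>f x / f v\<close>.\<close>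

lemma dim_kernel:
  fixes X :: "('a::field ^ 'n::finite) set"
  assumes X: "vec.subspace X" and f: "Vector_Spaces.linear (*s) (*) f"
    and v: "v \<in> X" "f v \<noteq> (0::'a)"
  shows "vec.dim X = vec.dim {x\<in>X. f x = 0} + 1"
proof -
  interpret f: Vector_Spaces.linear "(*s)" "(*)" f by fact
  let ?K = "{x\<in>X. f x = 0}"
  have K: "vec.span ?K = ?K"
    by (rule vec.span_eq_iff[THEN iffD2, OF subspace_kernel[OF X f]])
  have "vec.span (insert v ?K) = X"
  proof (rule vec.span_subspace[OF _ _ X])
    show "insert v ?K \<subseteq> X" using v by auto
    show "X \<subseteq> vec.span (insert v ?K)"
    proof
      fix x assume x: "x \<in> X"
      have "x - (f x / f v) *s v \<in> ?K"
        using x X v by (auto simp: f.diff f.scale vec.subspace_diff vec.subspace_scale)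
      then show "x \<in> vec.span (insert v ?K)"
        unfolding vec.span_insert K by blast
    qed
  qed
  then have "vec.dim X = vec.dim (insert v ?K)"
    using vec.dim_span[of "insert v ?K"] by simp
  also have "\<dots> = vec.dim ?K + 1"
    unfolding vec.dim_insert K using v by simp
  finally show ?thesis .
qed

lemma dim_kernel_le:
  fixes X :: "('a::field ^ 'n::finite) set"
  assumes "vec.subspace X" and "Vector_Spaces.linear (*s) (*) f"
  shows "vec.dim X \<le> vec.dim {x\<in>X. f x = (0::'a)} + 1"
proof (cases "\<exists>v\<in>X. f v \<noteq> 0")
  case True
  then show ?thesis using dim_kernel[OF assms] by fastforce
next
  case False
  then have "{x\<in>X. f x = 0} = X" by auto
  then show ?thesis by simp
qed

text \<open>For a subspace this is surjectivity of the projection to the coordinates in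
  \<open>J\<close>, in dual form. It replaces the generator matrix by the code itself.\<close>

definition separates_coordinates :: "('a::field ^ 'n::finite) set \<Rightarrow> 'n set \<Rightarrow> bool" where
  "separates_coordinates X J \<longleftrightarrow>
     (\<forall>c. (\<forall>x\<in>X. (\<Sum>j\<in>J. c j * x $ j) = 0) \<longrightarrow> (\<forall>j\<in>J. c j = 0))"

lemma codes_iff:
  "X \<in> codes t m \<longleftrightarrow>
     vec.subspace X \<and> vec.dim X = m \<and> (\<forall>J. card J = t \<longrightarrow> separates_coordinates X J)"
proof -
  have iff: "columns_independent m G J \<longleftrightarrow> separates_coordinates X J" if "generator_matrix m G X" for G J
    unfolding separates_coordinates_def using that by (rule columns_independent_iff)
  then have "X \<in> codes t m \<longleftrightarrow> linear_code m X \<and> (\<forall>J. card J = t \<longrightarrow> separates_coordinates X J)"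
    using generator_matrix_exists[of m X] unfolding codes_def by blast
  then show ?thesis by (simp add: linear_code_def)
qed

lemma separates_coordinates_mono:
  "separates_coordinates X J \<Longrightarrow> X \<subseteq> Y \<Longrightarrow> separates_coordinates Y J"
  unfolding separates_coordinates_def by blast

text \<open>Subtracting multiples of \<open>v\<close> moves \<open>X\<close> into the kernel of
  \<open>f\<close> without changing the coordinates in \<open>J\<close>, so both have the same
  projection to \<open>J\<close>.\<close>

lemma separates_coordinates_kernel:
  assumes X: "vec.subspace X" and f: "Vector_Spaces.linear (*s) (*) f"
    and v: "v \<in> X" "\<And>j. j \<in> J \<Longrightarrow> v $ j = 0" "f v \<noteq> (0::'a::field)"
    and sep: "separates_coordinates X J"
  shows "separates_coordinates {x\<in>X. f x = 0} J"
  unfolding separates_coordinates_def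
proof (intro allI impI)
  interpret f: Vector_Spaces.linear "(*s)" "(*)" f by fact
  fix c assume c: "\<forall>x\<in>{x\<in>X. f x = 0}. (\<Sum>j\<in>J. c j * x $ j) = 0"
  have "(\<Sum>j\<in>J. c j * x $ j) = 0" if x: "x \<in> X" for x
  proof -
    let ?y = "x - (f x / f v) *s v"
    have "?y \<in> {x\<in>X. f x = 0}"
      using x X v by (auto simp: f.diff f.scale vec.subspace_diff vec.subspace_scale)
    then have "(\<Sum>j\<in>J. c j * ?y $ j) = 0" using c by blast
    then show ?thesis using v(2) by simp
  qed
  then show "\<forall>j\<in>J. c j = 0" using sep unfolding separates_coordinates_def by blast
qed

lemma linear_coordinate_projection:
  "Vector_Spaces.linear (*s) (*s) (\<lambda>x :: 'a::field ^ 'n::finite. \<chi> j. if j \<in> J then x $ j else 0)"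
  by unfold_locales (auto simp: vec_eq_iff algebra_simps)

text \<open>The projection to \<open>J\<close> has an image of dimension at most
  \<open>card J\<close>, so it cannot be injective on \<open>X\<close>.\<close>

lemma ex_nonzero_vanishing_on:
  fixes X :: "('a::field ^ 'n::finite) set"
  assumes X: "vec.subspace X" and "card J < vec.dim X"
  shows "\<exists>v\<in>X \<inter> {v. \<forall>j\<in>J. v $ j = 0}. v \<noteq> 0"
proof (rule ccontr)
  assume none: "\<not> ?thesis"
  let ?p = "\<lambda>x :: 'a ^ 'n. \<chi> j. if j \<in> J then x $ j else 0"
  have "v = 0" if "v \<in> X" "?p v = 0" for v
  proof -
    have "v $ j = 0" if "j \<in> J" for j
      using \<open>?p v = 0\<close> that by (simp add: vec_eq_iff) metis
    then show ?thesis using none \<open>v \<in> X\<close> by blast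
  qed
  then have "inj_on ?p X"
    by (simp add: vec.linear_inj_on_iff_eq_0[OF linear_coordinate_projection X])
  then have "vec.dim X = vec.dim (?p ` X)"
    using vec.dim_image_eq[OF linear_coordinate_projection[of J], of X]
    by (simp add: vec.span_eq_iff[THEN iffD2, OF X])
  also have "\<dots> \<le> vec.dim {x :: 'a ^ 'n. \<forall>i. i \<notin> J \<longrightarrow> x $ i = 0}"
    by (rule vec.dim_subset) auto
  finally show False using assms(2) by (simp add: dim_substandard_cart)
qed

text \<open>Otherwise the projection of \<open>X\<close> misses some word supported on
  \<open>J\<close>. A functional that vanishes on the projection but not at this word yields a
  nontrivial relation among the coordinates in \<open>J\<close>.\<close>

lemma card_le_dim_of_separates_coordinates:
  fixes X :: "('a::field ^ 'n::finite) set"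
  assumes X: "vec.subspace X" and sep: "separates_coordinates X J"
  shows "card J \<le> vec.dim X"
proof (rule ccontr)
  assume less: "\<not> ?thesis"
  interpret vector_space_pair "(*s) :: 'a \<Rightarrow> 'a ^ 'n \<Rightarrow> 'a ^ 'n" "(*) :: 'a \<Rightarrow> 'a \<Rightarrow> 'a" ..
  let ?p = "\<lambda>x :: 'a ^ 'n. \<chi> j. if j \<in> J then x $ j else 0"
  let ?W = "{x :: 'a ^ 'n. \<forall>i. i \<notin> J \<longrightarrow> x $ i = 0}"
  have "\<not> ?W \<subseteq> ?p ` X"
  proof
    assume "?W \<subseteq> ?p ` X"
    then have "card J \<le> vec.dim (?p ` X)"
      using vec.dim_subset[of ?W "?p ` X"] by (simp add: dim_substandard_cart)
    also have "\<dots> \<le> vec.dim X"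
      by (rule vec.dim_image_le[OF linear_coordinate_projection])
    finally show False using less by simp
  qed
  then obtain w where w: "w \<in> ?W" "w \<notin> ?p ` X" by blast
  have "vec.subspace (?p ` X)"
    by (rule vec.linear_subspace_image[OF linear_coordinate_projection X])
  from functional_extend[OF this w(2) linear_zero, of 1]
  obtain f where f: "Vector_Spaces.linear (*s) (*) f" "\<forall>x\<in>?p ` X. f x = (0::'a)" "f w = 1"
    by blast
  interpret f: Vector_Spaces.linear "(*s)" "(*)" f by fact
  \<comment> \<open>The values of \<open>f\<close> on the unit vectors are the coefficients of the
    relation.\<close>
  have f_eq: "f (?p x) = (\<Sum>j\<in>J. f (axis j 1) * x $ j)" for x
  proof -
    have "?p x = (\<Sum>j\<in>J. x $ j *s axis j 1)"
      by (auto simp: vec_eq_iff axis_def if_distrib sum.delta cong: if_cong)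
    then show ?thesis by (simp add: f.sum f.scale mult.commute)
  qed
  have "\<forall>x\<in>X. (\<Sum>j\<in>J. f (axis j 1) * x $ j) = 0"
    using f(2) f_eq by auto
  then have "\<forall>j\<in>J. f (axis j 1) = 0"
    using sep[unfolded separates_coordinates_def, rule_format, of "\<lambda>j. f (axis j 1)"] by blast
  then have "f (?p w) = 0" by (simp add: f_eq)
  moreover have "?p w = w" using w(1) by (auto simp: vec_eq_iff)
  ultimately show False using f(3) by simp
qed

lemma kernel_in_codes:
  assumes X: "X \<in> codes t k" and f: "Vector_Spaces.linear (*s) (*) f"
    and "t \<le> CARD('n)"
    and v: "\<And>J. card J = t \<Longrightarrow> \<exists>v\<in>X \<inter> {v. \<forall>j\<in>J. v $ j = 0}. f v \<noteq> 0"
  shows "{x\<in>X. f x = 0} \<in> (codes t (k - 1) :: ('a::field ^ 'n::finite) set set)"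
proof -
  have sX: "vec.subspace X" and "vec.dim X = k"
    and sep: "\<And>J. card J = t \<Longrightarrow> separates_coordinates X J"
    using X by (auto simp: codes_iff)
  \<comment> \<open>The existence of one such \<open>J\<close> shows that \<open>f\<close> is not
    identically zero on \<open>X\<close>, so the dimension really drops.\<close>
  obtain J :: "'n set" where "card J = t"
    using obtain_subset_with_card_n[OF \<open>t \<le> CARD('n)\<close>] by blast
  then obtain w where "w \<in> X" "f w \<noteq> 0" using v by blast
  then have "vec.dim {x\<in>X. f x = 0} = k - 1"
    using dim_kernel[OF sX f] \<open>vec.dim X = k\<close> by auto
  moreover have "separates_coordinates {x\<in>X. f x = 0} J" if J: "card J = t" for J
  proof -
    obtain u where "u \<in> X" "\<forall>j\<in>J. u $ j = 0" "f u \<noteq> 0" using v[OF J] by blast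
    then show ?thesis
      using separates_coordinates_kernel[OF sX f] sep[OF J] by blast
  qed
  ultimately show ?thesis
    using subspace_kernel[OF sX f] codes_iff by blast
qed

subsection \<open>Edges of the code graph\<close>

text \<open>A word of \<open>X\<close> in the new span is a word of \<open>H\<close> plus a multiple
  of \<open>y\<close>; a nonzero multiple would force \<open>y\<close> into \<open>X\<close>. So the
  two codes meet exactly in \<open>H\<close>.\<close>

lemma exchange_adjacent:
  assumes X: "X \<in> codes t k" and H: "H \<in> codes t (k - 1)" "H \<subseteq> X"
    and y: "y \<notin> X" and "0 < k"
  shows "(X, vec.span (insert y H)) \<in> parcs (code_graph t k :: ('a::field ^ 'n::finite) set pair_pre_digraph)"
proof -
  have sX: "vec.subspace X" and sH: "vec.subspace H" and dH: "vec.dim H = k - 1"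
    using X H by (auto simp: codes_iff)
  have H_span: "vec.span H = H"
    using sH vec.span_eq_iff by blast
  let ?Z = "vec.span (insert y H)"
  have HZ: "H \<subseteq> ?Z"
    using vec.span_superset[of "insert y H"] by blast
  have "y \<notin> H" using H(2) y by blast
  then have "vec.dim ?Z = k"
    unfolding vec.dim_span vec.dim_insert H_span using dH \<open>0 < k\<close> by simp
  then have Z: "?Z \<in> codes t k"
    using H(1) separates_coordinates_mono[OF _ HZ] by (auto simp: codes_iff)
  have "X \<inter> ?Z \<subseteq> H"
  proof
    fix z assume z: "z \<in> X \<inter> ?Z"
    then obtain c where c: "z - c *s y \<in> H"
      by (auto simp: vec.span_insert H_span)
    have "z - (z - c *s y) \<in> X"
      by (rule vec.subspace_diff[OF sX]) (use z c H(2) in blast)+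
    then have "c *s y \<in> X" by simp
    have "c = 0"
    proof (rule ccontr)
      assume "c \<noteq> 0"
      then have "y = (1 / c) *s (c *s y)" by simp
      with vec.subspace_scale[OF sX \<open>c *s y \<in> X\<close>, of "1 / c"] y show False by metis
    qed
    then show "z \<in> H" using c by simp
  qed
  then have "X \<inter> ?Z = H" using H(2) HZ by blast
  then show ?thesis using X Z H(1) by (simp add: code_graph_def)
qed

lemma symmetric_code_graph: "symmetric (with_proj (code_graph t k))"
  by (auto simp: symmetric_def code_graph_def sym_def Int_commute)

lemma pair_wf_digraph_code_graph: "pair_wf_digraph (code_graph t k)"
  by unfold_locales (auto simp: code_graph_def)

lemma code_graph_reachable:
  fixes X Y :: "('a::{finite,field} ^ 'n::finite) set"
  assumes q: "CARD('n) choose t < CARD('a)" and "t < k" and "t \<le> CARD('n)"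
    and "X \<in> codes t k" and "Y \<in> codes t k"
  shows "X \<rightarrow>\<^sup>*\<^bsub>with_proj (code_graph t k)\<^esub> Y"
  using assms(4,5)
proof (induction "k - vec.dim (X \<inter> Y)" arbitrary: X Y rule: less_induct)
  case less
  note X = less.prems(1) and Y = less.prems(2)
  interpret pair_wf_digraph "code_graph t k :: ('a ^ 'n) set pair_pre_digraph"
    by (rule pair_wf_digraph_code_graph)
  let ?G = "code_graph t k :: ('a ^ 'n) set pair_pre_digraph"
  have sX: "vec.subspace X" and dX: "vec.dim X = k" and sY: "vec.subspace Y" and dY: "vec.dim Y = k"
    using X Y by (auto simp: codes_iff)
  have pverts: "pverts ?G = codes t k" by (simp add: code_graph_def)
  have sD: "vec.subspace (X \<inter> Y)" using sX sY by (rule vec.subspace_inter)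
  show ?case
  proof (cases "X = Y")
    case True
    then show ?thesis using X by (auto intro!: reachable_refl simp: pverts)
  next
    case False
    have d_less: "vec.dim (X \<inter> Y) < k"
    proof (rule ccontr)
      assume "\<not> vec.dim (X \<inter> Y) < k"
      then have "X \<inter> Y = X" "X \<inter> Y = Y"
        using vec.subspace_dim_equal[OF sD sX] vec.subspace_dim_equal[OF sD sY] dX dY by auto
      then show False using False by blast
    qed
    let ?I = "{J :: 'n set. card J = t}" and ?C = "\<lambda>J. {v :: 'a ^ 'n. \<forall>j\<in>J. v $ j = 0}"
    \<comment> \<open>There are \<open>CARD('n) choose t\<close> such sets of coordinates; this is
      where the bound on the field size enters.\<close>
    have I: "finite ?I" "card ?I < CARD('a)"
      using n_subsets[of "UNIV :: 'n set" t] q by simp_all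
    obtain f g where f: "Vector_Spaces.linear (*s) (*) f" and g: "Vector_Spaces.linear (*s) (*) g"
      and fg: "\<And>x. x \<in> X \<inter> Y \<Longrightarrow> f x = g x"
      and fv: "\<And>J. J \<in> ?I \<Longrightarrow> \<exists>v\<in>X \<inter> ?C J. f v \<noteq> 0"
      and gv: "\<And>J. J \<in> ?I \<Longrightarrow> \<exists>v\<in>Y \<inter> ?C J. g v \<noteq> 0"
    proof (rule functionals_agreeing_on_intersection[OF sX sY I, of ?C])
      show "\<exists>v\<in>X \<inter> ?C J. v \<noteq> 0" "\<exists>v\<in>Y \<inter> ?C J. v \<noteq> 0" if "J \<in> ?I" for J
        using that \<open>t < k\<close> dX dY
        by (intro ex_nonzero_vanishing_on[OF sX] ex_nonzero_vanishing_on[OF sY]; simp)+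
    qed (rule that)
    define X' where "X' = {x\<in>X. f x = 0}"
    define Y' where "Y' = {y\<in>Y. g y = 0}"
    have X': "X' \<in> codes t (k - 1)" and Y': "Y' \<in> codes t (k - 1)"
      unfolding X'_def Y'_def using fv gv
      by (intro kernel_in_codes[OF X f \<open>t \<le> CARD('n)\<close>] kernel_in_codes[OF Y g \<open>t \<le> CARD('n)\<close>];
          simp)+
    have sub: "X' \<subseteq> X" "Y' \<subseteq> Y" by (auto simp: X'_def Y'_def)
    \<comment> \<open>As \<open>X \<inter> Y\<close> has dimension at most k - 1, a code of
      dimension k - 1 inside it fills it. This settles the case where a hyperplane already lies in
      both codes and supplies no word to exchange.\<close>
    have adj: "X \<rightarrow>\<^sup>*\<^bsub>?G\<^esub> Y" if H: "H \<in> codes t (k - 1)" "H \<subseteq> X" "H \<subseteq> Y" for H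
    proof -
      have "H = X \<inter> Y"
        using vec.subspace_dim_equal[OF _ sD, of H] H d_less by (auto simp: codes_iff)
      then have "(X, Y) \<in> parcs ?G" using X Y H(1) by (simp add: code_graph_def)
      then show ?thesis by (intro reachable_adjI) simp
    qed
    show ?thesis
    proof (cases "X' \<subseteq> Y \<or> Y' \<subseteq> X")
      case True
      then show ?thesis using adj[OF X'] adj[OF Y'] sub by blast
    next
      case False
      then obtain x y where x: "x \<in> X'" "x \<notin> Y" and y: "y \<in> Y'" "y \<notin> X" by blast
      let ?X1 = "vec.span (insert y X')" and ?Y1 = "vec.span (insert x Y')"
      have "0 < k" using \<open>t < k\<close> by simp
      have eX: "(X, ?X1) \<in> parcs ?G" and eY: "(Y, ?Y1) \<in> parcs ?G"
        using exchange_adjacent[OF X X' sub(1) y(2) \<open>0 < k\<close>]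
          exchange_adjacent[OF Y Y' sub(2) x(2) \<open>0 < k\<close>] by auto
      \<comment> \<open>Since \<open>f\<close> and \<open>g\<close> agree on
        \<open>X \<inter> Y\<close>, \<open>?K\<close> lies in both hyperplanes. It loses at most
        one dimension against the intersection, while \<open>x\<close> and \<open>y\<close> add
        two.\<close>
      let ?K = "{z \<in> X \<inter> Y. f z = 0}"
      have K: "vec.span ?K = ?K"
        by (rule vec.span_eq_iff[THEN iffD2, OF subspace_kernel[OF sD f]])
      have "y \<notin> vec.span ?K" using y(2) unfolding K by blast
      moreover have "x \<notin> vec.span (insert y ?K)"
      proof -
        have "vec.span (insert y ?K) \<subseteq> Y"
          using y(1) sub(2) by (intro vec.span_minimal[OF _ sY]) auto
        then show ?thesis using x(2) by blast
      qed
      ultimately have "vec.dim (insert x (insert y ?K)) = vec.dim ?K + 2"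
        by (simp add: vec.dim_insert)
      moreover have "insert x (insert y ?K) \<subseteq> ?X1 \<inter> ?Y1"
        using x(1) y(1) fg by (auto simp: X'_def Y'_def intro!: vec.span_base)
      then have "vec.dim (insert x (insert y ?K)) \<le> vec.dim (?X1 \<inter> ?Y1)"
        by (rule vec.dim_subset)
      ultimately have "vec.dim (X \<inter> Y) < vec.dim (?X1 \<inter> ?Y1)"
        using dim_kernel_le[OF sD f] by linarith
      then have "k - vec.dim (?X1 \<inter> ?Y1) < k - vec.dim (X \<inter> Y)"
        using d_less by simp
      moreover have "?X1 \<in> codes t k" "?Y1 \<in> codes t k"
        using eX eY by (auto simp: code_graph_def)
      ultimately have X1Y1: "?X1 \<rightarrow>\<^sup>*\<^bsub>?G\<^esub> ?Y1" by (rule less.hyps)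
      have XX1: "X \<rightarrow>\<^sup>*\<^bsub>?G\<^esub> ?X1" and YY1: "Y \<rightarrow>\<^sup>*\<^bsub>?G\<^esub> ?Y1"
        using eX eY by (intro reachable_adjI; simp)+
      \<comment> \<open>The exchange at \<open>Y\<close> gives an edge leaving \<open>Y\<close>;
        symmetry allows it to be walked backwards.\<close>
      have "?Y1 \<rightarrow>\<^sup>*\<^bsub>?G\<^esub> Y"
        using symmetric_code_graph YY1 by (rule symmetric_reachable)
      then show ?thesis
        by (rule reachable_trans[OF reachable_trans[OF XX1 X1Y1]])
    qed
  qed
qed

theorem theorem1p9:
  fixes q n k t :: nat
  assumes "CARD('a::{finite,field}) = q"
    and "CARD('n::finite) = n"
    and "0 < k" and "k < n" and "t \<le> k"
  shows "(q > (n choose t) \<and> t < k \<longrightarrow>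
            graph_connected (code_graph t k :: ('a ^ 'n) set pair_pre_digraph)) \<and>
         (t = k \<longrightarrow>
            parcs (code_graph k k :: ('a ^ 'n) set pair_pre_digraph) = {})"
proof (intro conjI impI)
  let ?G = "code_graph t k :: ('a ^ 'n) set pair_pre_digraph"
  assume "q > (n choose t) \<and> t < k"
  then have reach: "X \<rightarrow>\<^sup>*\<^bsub>with_proj ?G\<^esub> Y" if "X \<in> pverts ?G" "Y \<in> pverts ?G" for X Y
    using code_graph_reachable[where 'a = 'a and 'n = 'n, of t k X Y] assms that
    by (auto simp: code_graph_def)
  interpret pair_wf_digraph ?G
    by (rule pair_wf_digraph_code_graph)
  \<comment> \<open>Connectedness in the library is strong connectedness of the symmetric closure,
    which inherits the directed walks.\<close>
  show "graph_connected ?G"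
    using reachable_mk_symmetricI[OF reach]
    by (auto simp: graph_connected_def Digraph_Component.connected_def strongly_connected_def)
next
  have "k \<le> CARD('n)" using assms by simp
  then obtain J :: "'n set" where J: "card J = k"
    using obtain_subset_with_card_n by blast
  \<comment> \<open>Here \<open>0 < k\<close> matters: for k = 0 the truncated subtraction would
    give k - 1 = k, and the dimension would not fall below \<open>card J\<close>.\<close>
  have "Z \<notin> codes k (k - 1)" for Z :: "('a ^ 'n) set"
    using card_le_dim_of_separates_coordinates[of Z J] J \<open>0 < k\<close> by (auto simp: codes_iff)
  then show "parcs (code_graph k k :: ('a ^ 'n) set pair_pre_digraph) = {}"
    by (auto simp: code_graph_def)
qed

end
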